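(* Let $n$ be an integer, $\theta_n$ a closed $\lambda C$-term with $\vdash_{C2}\theta_n:N[s^n(0)]$, and $x,g$ two distinct variables. (i) If $n=0$, then for every stack constant $p$: $(\theta_n)x\,g\,p\succ_C(x)p$. (ii) If $n\neq0$, then there exist $m\geq1$, indices $r_0,\dots,r_m\in\{0,\dots,m\}$ and a mapping $I:\{0,\dots,m\}\to\mathbb{N}$ such that for all distinct stack constants $p_0,\dots,p_m$ there are terms $t_1,\dots,t_m$ with $(\theta_n)x\,g\,p_0\succ_C(g)t_1p_{r_0}$; $(t_i)p_i\succ_C(g)t_{i+1}p_{r_i}$ for $1\leq i\leq m-1$; $(t_m)p_m\succ_C(x)p_{r_m}$; where $I(0)=n$, $I(r_m)=0$, and $I(i+1)=I(r_i)-1$ for $0\leq i\leq m-1$.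
   Context: $\lambda C$-terms are terms of the pure $\lambda$-calculus extended with a constant $C$; $(t)u_1\dots u_n$ is iterated application. Stack constants form an infinite set of further constants $p,p_0,p_1,\dots$ (distinct from $C$ and from variables) which may occur in terms and are never substituted. $\succ_C$ is the reflexive–transitive closure of $(\lambda xu)t\,t_1\dots t_n\to(u[t/x])t_1\dots t_n$ and $(C)t\,t_1\dots t_n\to(t)\lambda x(x)t_1\dots t_n$ ($x$ fresh). Types: second-order formulas over a language with constant $0$ and unary function $s$, built from $\perp$ and atomic formulas using $\rightarrow,\forall x,\forall X$; $\neg A=A\rightarrow\perp$; equations $u=v:=\forall Y(Y(u)\rightarrow Y(v))$; a fixed set of equations $E$, $a\approx b$ meaning $E$ entails $a=b$, assumed adequate: $s(a)\not\approx0$ and $s(a)\approx s(b)$ implies $a\approx b$. $C2$ typing rules: axiom; $\rightarrow$-intro/elim; $\forall x$-intro ($x$ not free in the context)/elim (any term); $\forall X$-intro ($X$ not free in the context)/elim (any formula); equational rule (from $t:A[u/x]$ and $u\approx v$ get $t:A[v/x]$); and $\Gamma\vdash C:\forall X\{\neg\neg X\rightarrow X\}$. $N[x]=\forall X\{X(0),\forall y(X(y)\rightarrow X(sy))\rightarrow X(x)\}$. *)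

theory Defs
  imports Main
begin

section \<open>\<open>\<lambda>C\<close>-terms and head reduction\<close>

text \<open>Terms are in de Bruijn notation; the free variables of a term are its dangling indices.
  \<open>Stk p\<close> is the stack constant number \<open>p\<close>.\<close>

datatype lam = Var nat | Abs lam | App lam lam (infixl "\<degree>" 200) | C | Stk nat

abbreviation apps :: "lam \<Rightarrow> lam list \<Rightarrow> lam" (infixl "\<degree>\<degree>" 190) where
  "t \<degree>\<degree> ts \<equiv> foldl App t ts"

primrec lift :: "nat \<Rightarrow> lam \<Rightarrow> lam" where
  "lift k (Var i) = Var (if i < k then i else Suc i)"
| "lift k (Abs t) = Abs (lift (Suc k) t)"
| "lift k (t \<degree> u) = lift k t \<degree> lift k u"
| "lift k C = C"
| "lift k (Stk p) = Stk p"

primrec subst :: "nat \<Rightarrow> lam \<Rightarrow> lam \<Rightarrow> lam" where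
  "subst k s (Var i) = (if i < k then Var i else if i = k then s else Var (i - 1))"
| "subst k s (Abs t) = Abs (subst (Suc k) (lift 0 s) t)"
| "subst k s (t \<degree> u) = subst k s t \<degree> subst k s u"
| "subst k s C = C"
| "subst k s (Stk p) = Stk p"

primrec fv :: "lam \<Rightarrow> nat set" where
  "fv (Var i) = {i}"
| "fv (Abs t) = {i. Suc i \<in> fv t}"
| "fv (t \<degree> u) = fv t \<union> fv u"
| "fv C = {}"
| "fv (Stk p) = {}"

definition closed :: "lam \<Rightarrow> bool" where
  "closed t \<longleftrightarrow> fv t = {}"

inductive step :: "lam \<Rightarrow> lam \<Rightarrow> bool" where
  beta: "step (Abs u \<degree> t \<degree>\<degree> ts) (subst 0 t u \<degree>\<degree> ts)"
| C: "step (C \<degree> t \<degree>\<degree> ts) (t \<degree> Abs (Var 0 \<degree>\<degree> map (lift 0) ts))"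

abbreviation reduces :: "lam \<Rightarrow> lam \<Rightarrow> bool" (infix "\<succ>\<^sub>C" 50) where
  "t \<succ>\<^sub>C u \<equiv> step\<^sup>*\<^sup>* t u"


section \<open>First-order terms and equations\<close>

text \<open>A language is given by a type \<open>'f\<close> of function symbols with an arity function \<open>ar\<close>;
  the symbols for \<open>0\<close> and successor are parameters where they are needed.\<close>

datatype 'f trm = TVar nat | Fn 'f "'f trm list"

primrec wf_trm :: "('f \<Rightarrow> nat) \<Rightarrow> 'f trm \<Rightarrow> bool" where
  "wf_trm ar (TVar i) \<longleftrightarrow> True"
| "wf_trm ar (Fn f ts) \<longleftrightarrow> length ts = ar f \<and> list_all (wf_trm ar) ts"

primrec tsubst :: "(nat \<Rightarrow> 'f trm) \<Rightarrow> 'f trm \<Rightarrow> 'f trm" where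
  "tsubst \<sigma> (TVar i) = \<sigma> i"
| "tsubst \<sigma> (Fn f ts) = Fn f (map (tsubst \<sigma>) ts)"

text \<open>\<open>entails ar E a b\<close> is the relation \<open>a \<approx> b\<close>: the equation \<open>a = b\<close> is derivable from \<open>E\<close> in
  equational logic. A pair \<open>(a, b) \<in> E\<close> is the equation \<open>a = b\<close>, its variables being universally
  quantified.\<close>

inductive entails :: "('f \<Rightarrow> nat) \<Rightarrow> ('f trm \<times> 'f trm) set \<Rightarrow> 'f trm \<Rightarrow> 'f trm \<Rightarrow> bool"
  for ar E where
  inst: "\<lbrakk>(a, b) \<in> E; \<And>i. wf_trm ar (\<sigma> i)\<rbrakk> \<Longrightarrow> entails ar E (tsubst \<sigma> a) (tsubst \<sigma> b)"
| refl: "wf_trm ar a \<Longrightarrow> entails ar E a a"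
| sym: "entails ar E a b \<Longrightarrow> entails ar E b a"
| trans: "\<lbrakk>entails ar E a b; entails ar E b c\<rbrakk> \<Longrightarrow> entails ar E a c"
| cong: "\<lbrakk>length as = ar f; list_all2 (entails ar E) as bs\<rbrakk> \<Longrightarrow> entails ar E (Fn f as) (Fn f bs)"

definition wf_eqs :: "('f \<Rightarrow> nat) \<Rightarrow> ('f trm \<times> 'f trm) set \<Rightarrow> bool" where
  "wf_eqs ar E \<longleftrightarrow> (\<forall>(a, b) \<in> E. wf_trm ar a \<and> wf_trm ar b)"

definition adequate :: "('f \<Rightarrow> nat) \<Rightarrow> 'f \<Rightarrow> 'f \<Rightarrow> ('f trm \<times> 'f trm) set \<Rightarrow> bool" where
  "adequate ar zero succ E \<longleftrightarrow>
     (\<forall>a. wf_trm ar a \<longrightarrow> \<not> entails ar E (Fn succ [a]) (Fn zero [])) \<and>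
     (\<forall>a b. wf_trm ar a \<longrightarrow> wf_trm ar b \<longrightarrow>
        entails ar E (Fn succ [a]) (Fn succ [b]) \<longrightarrow> entails ar E a b)"


section \<open>Second-order formulas\<close>

text \<open>Individual variables and, for each arity \<open>k\<close>, the \<open>k\<close>-ary predicate variables have separate
  de Bruijn index spaces: \<open>Atom X ts\<close> is \<open>X(ts)\<close> for the predicate variable with index \<open>X\<close> and
  arity \<open>length ts\<close>, and \<open>All2 k A\<close> binds index 0 among the \<open>k\<close>-ary predicate variables.\<close>

datatype 'f fm =
    Bot
  | Atom nat "'f trm list"
  | Imp "'f fm" "'f fm"
  | All1 "'f fm"
  | All2 nat "'f fm"

abbreviation Neg :: "'f fm \<Rightarrow> 'f fm" where
  "Neg A \<equiv> Imp A Bot"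

primrec wf_fm :: "('f \<Rightarrow> nat) \<Rightarrow> 'f fm \<Rightarrow> bool" where
  "wf_fm ar Bot \<longleftrightarrow> True"
| "wf_fm ar (Atom X ts) \<longleftrightarrow> list_all (wf_trm ar) ts"
| "wf_fm ar (Imp A B) \<longleftrightarrow> wf_fm ar A \<and> wf_fm ar B"
| "wf_fm ar (All1 A) \<longleftrightarrow> wf_fm ar A"
| "wf_fm ar (All2 k A) \<longleftrightarrow> wf_fm ar A"

primrec fsubst :: "(nat \<Rightarrow> 'f trm) \<Rightarrow> 'f fm \<Rightarrow> 'f fm" where
  "fsubst \<sigma> Bot = Bot"
| "fsubst \<sigma> (Atom X ts) = Atom X (map (tsubst \<sigma>) ts)"
| "fsubst \<sigma> (Imp A B) = Imp (fsubst \<sigma> A) (fsubst \<sigma> B)"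
| "fsubst \<sigma> (All1 A) = All1 (fsubst (case_nat (TVar 0) (\<lambda>i. tsubst (\<lambda>j. TVar (Suc j)) (\<sigma> i))) A)"
| "fsubst \<sigma> (All2 k A) = All2 k (fsubst \<sigma> A)"

definition lift1 :: "'f fm \<Rightarrow> 'f fm" where
  "lift1 A = fsubst (\<lambda>i. TVar (Suc i)) A"

text \<open>\<open>inst1 u A\<close> is \<open>A[u/x]\<close>, where \<open>x\<close> is the individual variable 0 of \<open>A\<close>.\<close>

definition inst1 :: "'f trm \<Rightarrow> 'f fm \<Rightarrow> 'f fm" where
  "inst1 u A = fsubst (case_nat u TVar) A"

primrec lift2 :: "nat \<Rightarrow> nat \<Rightarrow> 'f fm \<Rightarrow> 'f fm" where
  "lift2 k c Bot = Bot"
| "lift2 k c (Atom X ts) = Atom (if length ts = k \<and> c \<le> X then Suc X else X) ts"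
| "lift2 k c (Imp A B) = Imp (lift2 k c A) (lift2 k c B)"
| "lift2 k c (All1 A) = All1 (lift2 k c A)"
| "lift2 k c (All2 j A) = All2 j (lift2 k (if j = k then Suc c else c) A)"

text \<open>\<open>subst2 k n G A\<close> is \<open>A[G/X x\<^sub>1\<dots>x\<^sub>k]\<close>, where \<open>X\<close> is the \<open>k\<close>-ary predicate variable \<open>n\<close> of \<open>A\<close>
  (the variables above it being renumbered) and the parameters \<open>x\<^sub>1, \<dots>, x\<^sub>k\<close> of \<open>G\<close> are its individual
  variables \<open>0, \<dots>, k - 1\<close>; the individual variables of \<open>G\<close> from \<open>k\<close> on are its other ones.\<close>

primrec subst2 :: "nat \<Rightarrow> nat \<Rightarrow> 'f fm \<Rightarrow> 'f fm \<Rightarrow> 'f fm" where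
  "subst2 k n G Bot = Bot"
| "subst2 k n G (Atom X ts) =
     (if length ts = k \<and> X = n
      then fsubst (\<lambda>i. if i < k then ts ! i else TVar (i - k)) G
      else Atom (if length ts = k \<and> n < X then X - 1 else X) ts)"
| "subst2 k n G (Imp A B) = Imp (subst2 k n G A) (subst2 k n G B)"
| "subst2 k n G (All1 A) =
     All1 (subst2 k n (fsubst (\<lambda>i. if i < k then TVar i else TVar (Suc i)) G) A)"
| "subst2 k n G (All2 j A) =
     All2 j (subst2 k (if j = k then Suc n else n) (lift2 j 0 G) A)"


section \<open>The typing system \<open>C2\<close>\<close>

text \<open>\<open>C2 ar E \<Gamma> t A\<close> is the judgement \<open>\<Gamma> \<turnstile> t : A\<close>, where the variable \<open>i\<close> of \<open>t\<close> has type \<open>\<Gamma> ! i\<close>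
  in \<open>\<Gamma>\<close>. The eigenvariable conditions of the \<open>\<forall>\<close>-introductions are expressed by lifting \<open>\<Gamma>\<close>.
  Stack constants have no type.\<close>

inductive C2 ::
  "('f \<Rightarrow> nat) \<Rightarrow> ('f trm \<times> 'f trm) set \<Rightarrow> 'f fm list \<Rightarrow> lam \<Rightarrow> 'f fm \<Rightarrow> bool"
  for ar E where
  ax: "\<lbrakk>list_all (wf_fm ar) \<Gamma>; i < length \<Gamma>\<rbrakk> \<Longrightarrow> C2 ar E \<Gamma> (Var i) (\<Gamma> ! i)"
| imp_intro: "C2 ar E (A # \<Gamma>) t B \<Longrightarrow> C2 ar E \<Gamma> (Abs t) (Imp A B)"
| imp_elim: "\<lbrakk>C2 ar E \<Gamma> t (Imp A B); C2 ar E \<Gamma> u A\<rbrakk> \<Longrightarrow> C2 ar E \<Gamma> (t \<degree> u) B"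
| all1_intro: "C2 ar E (map lift1 \<Gamma>) t A \<Longrightarrow> C2 ar E \<Gamma> t (All1 A)"
| all1_elim: "\<lbrakk>C2 ar E \<Gamma> t (All1 A); wf_trm ar u\<rbrakk> \<Longrightarrow> C2 ar E \<Gamma> t (inst1 u A)"
| all2_intro: "C2 ar E (map (lift2 k 0) \<Gamma>) t A \<Longrightarrow> C2 ar E \<Gamma> t (All2 k A)"
| all2_elim: "\<lbrakk>C2 ar E \<Gamma> t (All2 k A); wf_fm ar G\<rbrakk> \<Longrightarrow> C2 ar E \<Gamma> t (subst2 k 0 G A)"
| eq: "\<lbrakk>C2 ar E \<Gamma> t (inst1 u A); entails ar E u v\<rbrakk> \<Longrightarrow> C2 ar E \<Gamma> t (inst1 v A)"
| C: "list_all (wf_fm ar) \<Gamma> \<Longrightarrow> C2 ar E \<Gamma> C (All2 0 (Imp (Neg (Neg (Atom 0 []))) (Atom 0 [])))"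

primrec numeral_trm :: "'f \<Rightarrow> 'f \<Rightarrow> nat \<Rightarrow> 'f trm" where
  "numeral_trm zero succ 0 = Fn zero []"
| "numeral_trm zero succ (Suc n) = Fn succ [numeral_trm zero succ n]"

definition N :: "'f \<Rightarrow> 'f \<Rightarrow> 'f trm \<Rightarrow> 'f fm" where
  "N zero succ u =
     All2 1 (Imp (Atom 0 [Fn zero []])
       (Imp (All1 (Imp (Atom 0 [TVar 0]) (Atom 0 [Fn succ [TVar 0]])))
         (Atom 0 [u])))"

end

theory Submission
  imports Defs "HOL-Library.Nat_Bijection"
begin

text \<open>The proof interprets types by the terms that realize them, in the style of Krivine. Fix
  a map \<open>val\<close> that gives every stack constant a natural number and takes each value infinitely often, and let the pole be the least set of terms closed under
  anti-reduction that contains \<open>(x)q\<close> when \<open>val q = 0\<close>, and \<open>(g)t q\<close> when \<open>val q = k + 1\<close> and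
  \<open>(t)q'\<close> is in the pole for every \<open>q'\<close> of value \<open>k\<close>. Interpret formulas by sets of stacks,
  with \<open>\<bottom>\<close> interpreted by the empty stack alone, because the rule for \<open>C\<close> captures its whole
  argument list. Sending \<open>X(a)\<close> to the stacks \<open>q\<close> with \<open>s\<^bsup>val q\<^esup>(0) \<approx> a\<close>, adequacy of \<open>E\<close> lets \<open>x\<close>
  and \<open>g\<close> realize the two premises of \<open>N\<close>, so \<open>(\<theta>)x g q\<close> lies in the pole when \<open>val q = n\<close>. Following the
  derivation of this fact, always with a fresh \<open>q'\<close>, gives the required sequence of reductions.
  A typable term contains no stack constant, so the constants chosen can be renamed to arbitrary ones.\<close>

section \<open>Substitution in \<open>\<lambda>C\<close>-terms\<close>

lemma lift_lift: "i < Suc k \<Longrightarrow> lift (Suc k) (lift i t) = lift i (lift k t)"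
  by (induction t arbitrary: i k) auto

lemma lift_subst:
  "i < Suc k \<Longrightarrow> lift i (subst k s t) = subst (Suc k) (lift i s) (lift i t)"
  by (induction t arbitrary: i k s) (auto simp: lift_lift)

lemma subst_lift: "subst k s (lift k t) = t"
  by (induction t arbitrary: k s) auto

text \<open>Adequacy replaces all context variables by realizers at once, whereas
  \<open>subst\<close> treats a single index; hence this parallel substitution.\<close>

primrec psubst :: "(nat \<Rightarrow> lam) \<Rightarrow> lam \<Rightarrow> lam" where
  "psubst \<sigma> (Var i) = \<sigma> i"
| "psubst \<sigma> (Abs t) = Abs (psubst (case_nat (Var 0) (\<lambda>i. lift 0 (\<sigma> i))) t)"
| "psubst \<sigma> (t \<degree> u) = psubst \<sigma> t \<degree> psubst \<sigma> u"
| "psubst \<sigma> C = C"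
| "psubst \<sigma> (Stk p) = Stk p"

lemma psubst_Var: "psubst Var t = t"
proof (induction t)
  case (Abs t)
  moreover have "case_nat (Var 0) (\<lambda>i. lift 0 (Var i)) = Var"
    by (auto split: nat.split)
  ultimately show ?case by simp
qed auto

lemma subst_psubst: "subst k s (psubst \<sigma> t) = psubst (\<lambda>i. subst k s (\<sigma> i)) t"
proof (induction t arbitrary: k s \<sigma>)
  case (Abs t)
  have "(\<lambda>i. subst (Suc k) (lift 0 s) (case_nat (Var 0) (\<lambda>i. lift 0 (\<sigma> i)) i)) =
      case_nat (Var 0) (\<lambda>i. lift 0 (subst k s (\<sigma> i)))"
    by (auto simp: lift_subst split: nat.split)
  with Abs show ?case by simp
qed auto

text \<open>Substituting for index 0 undoes the lifting of every \<open>\<sigma> i\<close>, so the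
  contractum of a beta step is again a parallel substitution, with \<open>u\<close> pushed onto the
  environment.\<close>

lemma subst_psubst_up:
  "subst 0 u (psubst (case_nat (Var 0) (\<lambda>i. lift 0 (\<sigma> i))) t) = psubst (case_nat u \<sigma>) t"
proof -
  have "(\<lambda>i. subst 0 u (case_nat (Var 0) (\<lambda>i. lift 0 (\<sigma> i)) i)) = case_nat u \<sigma>"
    by (auto simp: subst_lift split: nat.split)
  then show ?thesis by (simp add: subst_psubst)
qed

lemma subst_apps: "subst k s (t \<degree>\<degree> ts) = subst k s t \<degree>\<degree> map (subst k s) ts"
  by (induction ts arbitrary: t) auto


section \<open>Stack constants\<close>

primrec stks :: "lam \<Rightarrow> nat set" where
  "stks (Var i) = {}"
| "stks (Abs t) = stks t"
| "stks (t \<degree> u) = stks t \<union> stks u"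
| "stks C = {}"
| "stks (Stk p) = {p}"

lemma stks_lift [simp]: "stks (lift k t) = stks t"
  by (induction t arbitrary: k) auto

lemma stks_subst: "stks (subst k s t) \<subseteq> stks s \<union> stks t"
proof (induction t arbitrary: k s)
  case (Abs t)
  show ?case using Abs [of "Suc k" "lift 0 s"] by simp
next
  case (App t u)
  show ?case using App [of k s] by auto
qed auto

lemma stks_apps [simp]: "stks (t \<degree>\<degree> ts) = stks t \<union> (\<Union>u\<in>set ts. stks u)"
  by (induction ts arbitrary: t) auto

lemma stks_step: "step t u \<Longrightarrow> stks u \<subseteq> stks t"
  by (induction rule: step.induct) (use stks_subst in auto)

lemma C2_stks: "C2 ar E \<Gamma> t A \<Longrightarrow> stks t = {}"
  by (induction rule: C2.induct) auto

text \<open>No reduction rule inspects a constant, so reductions survive an arbitrary map on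
  constants, even one that identifies some of them.\<close>

primrec rename :: "(nat \<Rightarrow> nat) \<Rightarrow> lam \<Rightarrow> lam" where
  "rename f (Var i) = Var i"
| "rename f (Abs t) = Abs (rename f t)"
| "rename f (t \<degree> u) = rename f t \<degree> rename f u"
| "rename f C = C"
| "rename f (Stk p) = Stk (f p)"

lemma rename_lift: "rename f (lift k t) = lift k (rename f t)"
  by (induction t arbitrary: k) auto

lemma rename_subst: "rename f (subst k s t) = subst k (rename f s) (rename f t)"
  by (induction t arbitrary: k s) (auto simp: rename_lift)

lemma rename_apps: "rename f (t \<degree>\<degree> ts) = rename f t \<degree>\<degree> map (rename f) ts"
  by (induction ts arbitrary: t) auto

lemma rename_id: "stks t = {} \<Longrightarrow> rename f t = t"
  by (induction t) auto

lemma rename_step: "step t u \<Longrightarrow> step (rename f t) (rename f u)"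
proof (induction rule: step.induct)
  case (beta u t ts)
  show ?case by (simp add: rename_apps rename_subst step.beta)
next
  case (C t ts)
  show ?case
    using step.C [of "rename f t" "map (rename f) ts"]
    by (simp add: rename_apps rename_lift comp_def)
qed

lemma rename_reduces: "t \<succ>\<^sub>C u \<Longrightarrow> rename f t \<succ>\<^sub>C rename f u"
  by (induction rule: rtranclp_induct) (auto intro: rename_step rtranclp.rtrancl_into_rtrancl)


section \<open>Well-formedness and substitution in formulas\<close>

lemma tsubst_tsubst: "tsubst \<eta> (tsubst \<sigma> t) = tsubst (\<lambda>i. tsubst \<eta> (\<sigma> i)) t"
  by (induction t) auto

lemma wf_tsubst: "wf_trm ar t \<Longrightarrow> (\<And>i. wf_trm ar (\<sigma> i)) \<Longrightarrow> wf_trm ar (tsubst \<sigma> t)"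
  by (induction t) (auto simp: list_all_iff)

lemma wf_tsubstD: "wf_trm ar (tsubst \<sigma> t) \<Longrightarrow> wf_trm ar t"
  by (induction t) (auto simp: list_all_iff)

lemma wf_fsubst: "wf_fm ar A \<Longrightarrow> (\<And>i. wf_trm ar (\<sigma> i)) \<Longrightarrow> wf_fm ar (fsubst \<sigma> A)"
proof (induction A arbitrary: \<sigma>)
  case (All1 A)
  then show ?case by (auto split: nat.split intro!: All1.IH wf_tsubst)
qed (auto simp: list_all_iff wf_tsubst)

lemma wf_fsubstD: "wf_fm ar (fsubst \<sigma> A) \<Longrightarrow> wf_fm ar A"
  by (induction A arbitrary: \<sigma>) (auto simp: list_all_iff dest: wf_tsubstD)

lemma wf_lift2 [simp]: "wf_fm ar (lift2 k c A) = wf_fm ar A"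
  by (induction A arbitrary: c) auto

lemma wf_subst2: "wf_fm ar A \<Longrightarrow> wf_fm ar G \<Longrightarrow> wf_fm ar (subst2 k n G A)"
proof (induction A arbitrary: n G)
  case (All1 A)
  then show ?case by (simp add: wf_fsubst)
qed (auto simp: list_all_iff intro!: wf_fsubst)

lemma entails_wf: "entails ar E a b \<Longrightarrow> wf_eqs ar E \<Longrightarrow> wf_trm ar a \<and> wf_trm ar b"
proof (induction rule: entails.induct)
  case (cong as f bs)
  then show ?case by (auto simp: list_all2_conv_all_nth list_all_length)
qed (auto simp: wf_eqs_def intro!: wf_tsubst)

text \<open>This serves the equational rule, whose premise shows only the instance
  \<open>inst1 u A\<close>: well-formedness passes from there back to \<open>A\<close>, as
  \<open>sem_cong\<close> requires.\<close>

lemma C2_wf: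
  "C2 ar E \<Gamma> t A \<Longrightarrow> wf_eqs ar E \<Longrightarrow> list_all (wf_fm ar) \<Gamma> \<and> wf_fm ar A"
proof (induction rule: C2.induct)
  case (all1_intro \<Gamma> t A)
  then show ?case by (auto simp: list_all_iff lift1_def dest: wf_fsubstD)
next
  case (all1_elim \<Gamma> t A u)
  then show ?case by (auto simp: inst1_def split: nat.split intro!: wf_fsubst)
next
  case (eq \<Gamma> t u A v)
  then show ?case
    by (auto simp: inst1_def split: nat.split intro!: wf_fsubst dest: wf_fsubstD entails_wf)
qed (auto simp: list_all_iff intro!: wf_subst2)

section \<open>Entailment under substitution\<close>

lemma entails_tsubst:
  assumes "entails ar E a b" and \<eta>: "\<And>i. wf_trm ar (\<eta> i)"
  shows "entails ar E (tsubst \<eta> a) (tsubst \<eta> b)"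
  using assms(1)
proof (induction rule: entails.induct)
  case (inst a b \<sigma>)
  then show ?case
    using entails.inst [of a b E ar "\<lambda>i. tsubst \<eta> (\<sigma> i)"] \<eta> by (simp add: tsubst_tsubst wf_tsubst)
next
  case (refl a)
  then show ?case by (simp add: entails.refl wf_tsubst \<eta>)
next
  case (cong as f bs)
  then show ?case by (auto intro!: entails.cong simp: list_all2_conv_all_nth)
qed (auto intro: entails.sym entails.trans)

lemma entails_tsubst_cong:
  assumes "wf_trm ar t" and "\<And>i. entails ar E (\<eta> i) (\<eta>' i)"
  shows "entails ar E (tsubst \<eta> t) (tsubst \<eta>' t)"
  using assms(1)
proof (induction t)
  case (TVar i)
  then show ?case by (simp add: assms)
next
  case (Fn f ts)
  then show ?case by (auto intro!: entails.cong simp: list_all2_conv_all_nth list_all_length)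
qed


section \<open>The realizing relation\<close>

text \<open>Adequacy is proved for every pole closed under anti-reduction; \<open>runs x g\<close>
  is put in for it later.\<close>

locale pole_model =
  fixes ar :: "'f \<Rightarrow> nat" and E :: "('f trm \<times> 'f trm) set" and pole :: "lam \<Rightarrow> bool"
  assumes wf_E: "wf_eqs ar E"
    and pole_step: "step t u \<Longrightarrow> pole u \<Longrightarrow> pole t"
begin

definition realizes :: "lam \<Rightarrow> lam list set \<Rightarrow> bool" where
  "realizes t S \<longleftrightarrow> (\<forall>\<pi>\<in>S. pole (t \<degree>\<degree> \<pi>))"

text \<open>Second-order quantifiers range over predicates that respect entailed equality; this
  makes the equational rule sound.\<close>

definition ext :: "nat \<Rightarrow> ('f trm list \<Rightarrow> lam list set) \<Rightarrow> bool" where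
  "ext k P \<longleftrightarrow> (\<forall>ts ts'. length ts = k \<longrightarrow> list_all2 (entails ar E) ts ts' \<longrightarrow> P ts = P ts')"

text \<open>These are falsity values: a stack in \<open>sem A\<close> is a test that a realizer of
  \<open>A\<close> must pass, so quantifiers become unions. Quantified individuals are well-formed,
  possibly open terms. \<open>case_nat\<close> pushes the value of a newly bound variable to index
  0.\<close>

primrec sem :: "'f fm \<Rightarrow> (nat \<Rightarrow> 'f trm) \<Rightarrow> (nat \<Rightarrow> nat \<Rightarrow> 'f trm list \<Rightarrow> lam list set) \<Rightarrow>
    lam list set" where
  "sem Bot \<eta> \<rho> = {[]}"
| "sem (Atom X ts) \<eta> \<rho> = \<rho> (length ts) X (map (tsubst \<eta>) ts)"
| "sem (Imp A B) \<eta> \<rho> = {t # \<pi> |t \<pi>. realizes t (sem A \<eta> \<rho>) \<and> \<pi> \<in> sem B \<eta> \<rho>}"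
| "sem (All1 A) \<eta> \<rho> = (\<Union>a\<in>{a. wf_trm ar a}. sem A (case_nat a \<eta>) \<rho>)"
| "sem (All2 k A) \<eta> \<rho> = (\<Union>P\<in>{P. ext k P}. sem A \<eta> (\<rho>(k := case_nat P (\<rho> k))))"

section \<open>Falsity values of lifted and substituted formulas\<close>

lemma sem_fsubst: "sem (fsubst \<sigma> A) \<eta> \<rho> = sem A (\<lambda>i. tsubst \<eta> (\<sigma> i)) \<rho>"
proof (induction A arbitrary: \<sigma> \<eta> \<rho>)
  case (All1 A)
  have "(\<lambda>i. tsubst (case_nat a \<eta>) (case_nat (TVar 0) (\<lambda>i. tsubst (\<lambda>j. TVar (Suc j)) (\<sigma> i)) i)) =
      case_nat a (\<lambda>i. tsubst \<eta> (\<sigma> i))" for a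
    by (auto simp: tsubst_tsubst split: nat.split)
  with All1 show ?case by simp
qed (auto simp: tsubst_tsubst comp_def)

lemma sem_lift1: "sem (lift1 A) (case_nat a \<eta>) \<rho> = sem A \<eta> \<rho>"
  by (simp add: lift1_def sem_fsubst)

lemma sem_inst1: "sem (inst1 u A) \<eta> \<rho> = sem A (case_nat (tsubst \<eta> u) \<eta>) \<rho>"
proof -
  have "(\<lambda>i. tsubst \<eta> (case_nat u TVar i)) = case_nat (tsubst \<eta> u) \<eta>"
    by (auto split: nat.split)
  then show ?thesis by (simp add: inst1_def sem_fsubst)
qed

text \<open>A lifted formula never mentions the \<open>k\<close>-ary variable \<open>c\<close>, so
  it sees the valuation with that entry dropped.\<close>

lemma sem_lift2:
  "sem (lift2 k c A) \<eta> \<rho> = sem A \<eta> (\<rho>(k := \<lambda>X. \<rho> k (if c \<le> X then Suc X else X)))"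
proof (induction A arbitrary: c \<eta> \<rho>)
  case (All2 j A)
  define \<rho>' where "\<rho>' = \<rho>(k := \<lambda>X. \<rho> k (if c \<le> X then Suc X else X))"
  have "sem (lift2 k (if j = k then Suc c else c) A) \<eta> (\<rho>(j := case_nat P (\<rho> j))) =
      sem A \<eta> (\<rho>'(j := case_nat P (\<rho>' j)))" for P
    unfolding All2 by (rule arg_cong [of _ _ "sem A \<eta>"])
      (auto simp: fun_eq_iff \<rho>'_def split: nat.split)
  then show ?case by (simp only: lift2.simps sem.simps flip: \<rho>'_def)
qed auto

lemma sem_lift2_0: "sem (lift2 k 0 A) \<eta> (\<rho>(k := case_nat P (\<rho> k))) = sem A \<eta> \<rho>"
  by (simp add: sem_lift2)

text \<open>Substitution turns into insertion: variable \<open>n\<close> receives the meaning of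
  \<open>G\<close> as a function of its \<open>k\<close> parameters, and the entries from
  \<open>n\<close> on move up by one.\<close>

lemma sem_subst2:
  "sem (subst2 k n G A) \<eta> \<rho> =
   sem A \<eta> (\<rho>(k := \<lambda>X. if X < n then \<rho> k X
     else if X = n then \<lambda>ts. sem G (\<lambda>i. if i < k then ts ! i else \<eta> (i - k)) \<rho>
     else \<rho> k (X - 1)))"
proof (induction A arbitrary: n G \<eta> \<rho>)
  case (Atom X ts)
  have "(\<lambda>i. tsubst \<eta> (if i < length ts then ts ! i else TVar (i - length ts))) =
      (\<lambda>i. if i < length ts then map (tsubst \<eta>) ts ! i else \<eta> (i - length ts))"
    by auto
  then show ?case by (auto simp: sem_fsubst)
next
  case (All1 A)
  have "(\<lambda>i. tsubst (\<lambda>i. if i < k then ts ! i else case_nat a \<eta> (i - k))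
          (if i < k then TVar i else TVar (Suc i))) =
      (\<lambda>i. if i < k then ts ! i else \<eta> (i - k))" for a and ts :: "'f trm list"
    by (auto simp: Suc_diff_le)
  then show ?case by (simp add: All1 sem_fsubst cong: if_cong)
next
  case (All2 j A)
  define \<rho>' where "\<rho>' = \<rho>(k := \<lambda>X. if X < n then \<rho> k X
     else if X = n then \<lambda>ts. sem G (\<lambda>i. if i < k then ts ! i else \<eta> (i - k)) \<rho>
     else \<rho> k (X - 1))"
  \<comment> \<open>The lifted \<open>G\<close> cannot refer to the newly bound variable, so
    \<open>sem_lift2_0\<close> removes \<open>P\<close> from its meaning.\<close>
  have "sem (subst2 k (if j = k then Suc n else n) (lift2 j 0 G) A) \<eta>
      (\<rho>(j := case_nat P (\<rho> j))) = sem A \<eta> (\<rho>'(j := case_nat P (\<rho>' j)))" for P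
    unfolding All2 sem_lift2_0 by (rule arg_cong [of _ _ "sem A \<eta>"])
      (auto simp: fun_eq_iff \<rho>'_def split: nat.split)
  then show ?case by (simp only: subst2.simps sem.simps flip: \<rho>'_def)
qed auto

lemma sem_cong:
  assumes "wf_fm ar A" and "\<And>i. entails ar E (\<eta> i) (\<eta>' i)" and "\<And>k X. ext k (\<rho> k X)"
  shows "sem A \<eta> \<rho> = sem A \<eta>' \<rho>"
  using assms
proof (induction A arbitrary: \<eta> \<eta>' \<rho>)
  case (Atom X ts)
  have "list_all2 (entails ar E) (map (tsubst \<eta>) ts) (map (tsubst \<eta>') ts)"
    using Atom.prems
    by (auto simp: list_all2_conv_all_nth list_all_length intro!: entails_tsubst_cong)
  then show ?case using Atom.prems(3) by (auto simp: ext_def)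
next
  case (Imp A B)
  then have "sem A \<eta> \<rho> = sem A \<eta>' \<rho>" "sem B \<eta> \<rho> = sem B \<eta>' \<rho>"
    by (auto intro!: Imp.IH)
  then show ?case by simp
next
  case (All1 A)
  have "sem A (case_nat a \<eta>) \<rho> = sem A (case_nat a \<eta>') \<rho>" if "wf_trm ar a" for a
    using All1.prems that by (intro All1.IH) (auto intro: entails.refl split: nat.split)
  then show ?case by simp
next
  case (All2 k A)
  have "sem A \<eta> (\<rho>(k := case_nat P (\<rho> k))) = sem A \<eta>' (\<rho>(k := case_nat P (\<rho> k)))"
    if "ext k P" for P
    using All2.prems that by (intro All2.IH) (auto split: nat.split)
  then show ?case by simp
qed auto

text \<open>Semantic comprehension: the meaning of a formula is an admissible predicate, hence a
  legitimate value for the variable instantiated in \<open>all2_elim\<close>.\<close>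

lemma ext_sem:
  assumes "wf_fm ar G" and "\<And>i. wf_trm ar (\<eta> i)" and "\<And>k X. ext k (\<rho> k X)"
  shows "ext k (\<lambda>ts. sem G (\<lambda>i. if i < k then ts ! i else \<eta> (i - k)) \<rho>)"
  unfolding ext_def
proof (intro allI impI sem_cong)
  fix ts ts' i assume "length ts = k" "list_all2 (entails ar E) ts ts'"
  then show "entails ar E (if i < k then ts ! i else \<eta> (i - k)) (if i < k then ts' ! i else \<eta> (i - k))"
    using assms(2) by (auto simp: list_all2_conv_all_nth intro: entails.refl)
qed (use assms in auto)

text \<open>A stack against this type is \<open>t # \<pi>'\<close> with \<open>\<pi>'\<close> in
  \<open>P []\<close>. \<open>C\<close> passes to \<open>t\<close> an abstraction that saves
  \<open>\<pi>'\<close>. As \<open>sem Bot\<close> holds only the empty stack, it remains to apply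
  this abstraction to a realizer \<open>u\<close> of the predicate, and that reduces to
  \<open>u\<close> against \<open>\<pi>'\<close>.\<close>

lemma realizes_C: "realizes C (sem (All2 0 (Imp (Neg (Neg (Atom 0 []))) (Atom 0 []))) \<eta> \<rho>)"
  unfolding realizes_def
proof
  fix \<pi> assume "\<pi> \<in> sem (All2 0 (Imp (Neg (Neg (Atom 0 []))) (Atom 0 []))) \<eta> \<rho>"
  then obtain P t \<pi>' where \<pi>: "\<pi> = t # \<pi>'" "\<pi>' \<in> P []"
    and "realizes t (sem (Neg (Neg (Atom 0 []))) \<eta> (\<rho>(0 := case_nat P (\<rho> 0))))"
    by auto
  then have t: "pole (t \<degree> v)" if "\<And>u. realizes u (P []) \<Longrightarrow> pole (v \<degree> u)" for v
  proof -
    have "[v] \<in> sem (Neg (Neg (Atom 0 []))) \<eta> (\<rho>(0 := case_nat P (\<rho> 0)))"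
      using that by (auto simp: realizes_def [of v])
    then show ?thesis
      using \<open>realizes t _\<close> by (auto simp only: realizes_def [of t] foldl.simps dest: bspec)
  qed
  have "pole (Abs (Var 0 \<degree>\<degree> map (lift 0) \<pi>') \<degree> u)" if "realizes u (P [])" for u
  proof -
    have "pole (u \<degree>\<degree> \<pi>')"
      using that \<pi>(2) by (simp add: realizes_def)
    moreover have "step (Abs (Var 0 \<degree>\<degree> map (lift 0) \<pi>') \<degree> u) (u \<degree>\<degree> \<pi>')"
      using step.beta [of "Var 0 \<degree>\<degree> map (lift 0) \<pi>'" u "[]"]
      by (simp add: subst_apps subst_lift comp_def)
    ultimately show ?thesis by (rule pole_step [rotated])
  qed
  then have "pole (t \<degree> Abs (Var 0 \<degree>\<degree> map (lift 0) \<pi>'))"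
    by (rule t)
  then show "pole (C \<degree>\<degree> \<pi>)"
    using pole_step [OF step.C [of t \<pi>']] by (simp add: \<pi>)
qed

theorem adequacy:
  assumes "C2 ar E \<Gamma> t A"
    and "\<And>i. wf_trm ar (\<eta> i)" and "\<And>k X. ext k (\<rho> k X)"
    and "\<And>i. i < length \<Gamma> \<Longrightarrow> realizes (\<sigma> i) (sem (\<Gamma> ! i) \<eta> \<rho>)"
  shows "realizes (psubst \<sigma> t) (sem A \<eta> \<rho>)"
  using assms
proof (induction arbitrary: \<eta> \<rho> \<sigma> rule: C2.induct)
  case (ax \<Gamma> i)
  then show ?case by simp
next
  case (imp_intro A \<Gamma> t B)
  have "pole (Abs (psubst (case_nat (Var 0) (\<lambda>i. lift 0 (\<sigma> i))) t) \<degree> u \<degree>\<degree> \<pi>)"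
    if "realizes u (sem A \<eta> \<rho>)" "\<pi> \<in> sem B \<eta> \<rho>" for u \<pi>
  proof -
    have "realizes (psubst (case_nat u \<sigma>) t) (sem B \<eta> \<rho>)"
      using imp_intro.prems that
      by (intro imp_intro.IH) (auto split: nat.split simp: nth_Cons)
    then have "pole (psubst (case_nat u \<sigma>) t \<degree>\<degree> \<pi>)"
      using that by (simp add: realizes_def)
    then show ?thesis
      using pole_step [OF step.beta] by (simp add: subst_psubst_up)
  qed
  then show ?case by (auto simp: realizes_def)
next
  case (imp_elim \<Gamma> t A B u)
  have "realizes (psubst \<sigma> t) (sem (Imp A B) \<eta> \<rho>)" "realizes (psubst \<sigma> u) (sem A \<eta> \<rho>)"
    using imp_elim.prems by (auto intro!: imp_elim.IH simp del: sem.simps)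
  then show ?case by (force simp: realizes_def [of "psubst \<sigma> t"] realizes_def [of "_ \<degree> _"])
next
  case (all1_intro \<Gamma> t A)
  have "realizes (psubst \<sigma> t) (sem A (case_nat a \<eta>) \<rho>)" if "wf_trm ar a" for a
    using all1_intro.prems that
    by (intro all1_intro.IH) (auto split: nat.split simp: sem_lift1)
  then show ?case by (auto simp: realizes_def)
next
  case (all1_elim \<Gamma> t A u)
  have "realizes (psubst \<sigma> t) (sem (All1 A) \<eta> \<rho>)"
    using all1_elim.prems by (intro all1_elim.IH)
  moreover have "wf_trm ar (tsubst \<eta> u)"
    using all1_elim by (simp add: wf_tsubst)
  ultimately show ?case by (auto simp: realizes_def sem_inst1)
next
  case (all2_intro k \<Gamma> t A)
  have "realizes (psubst \<sigma> t) (sem A \<eta> (\<rho>(k := case_nat P (\<rho> k))))" if "ext k P" for P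
  proof (rule all2_intro.IH)
    fix i assume "i < length (map (lift2 k 0) \<Gamma>)"
    then show "realizes (\<sigma> i) (sem (map (lift2 k 0) \<Gamma> ! i) \<eta> (\<rho>(k := case_nat P (\<rho> k))))"
      using all2_intro.prems(3) by (simp add: sem_lift2_0 del: fun_upd_apply)
  qed (use all2_intro.prems that in \<open>auto split: nat.split\<close>)
  then show ?case by (auto simp: realizes_def)
next
  case (all2_elim \<Gamma> t k A G)
  have "realizes (psubst \<sigma> t) (sem (All2 k A) \<eta> \<rho>)"
    using all2_elim.prems by (intro all2_elim.IH)
  moreover have "ext k (\<lambda>ts. sem G (\<lambda>i. if i < k then ts ! i else \<eta> (i - k)) \<rho>)"
    using all2_elim by (intro ext_sem)
  \<comment> \<open>At index 0 the insertion of \<open>sem_subst2\<close> is a plain push, as in the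
    clause for \<open>All2\<close>.\<close>
  moreover have "(\<lambda>X. if X < 0 then \<rho> k X else if X = 0 then P else \<rho> k (X - 1)) =
      case_nat P (\<rho> k)" for P
    by (auto split: nat.split)
  ultimately show ?case by (auto simp: realizes_def sem_subst2)
next
  case (eq \<Gamma> t u A v)
  have "wf_fm ar A"
    using C2_wf [OF eq.hyps(1) wf_E] by (auto simp: inst1_def dest: wf_fsubstD)
  \<comment> \<open>\<open>u\<close> and \<open>v\<close> remain entailed equal after applying
    \<open>\<eta>\<close>, so both instances have the same falsity value.\<close>
  then have "sem (inst1 u A) \<eta> \<rho> = sem (inst1 v A) \<eta> \<rho>"
    unfolding sem_inst1 using eq
    by (intro sem_cong) (auto split: nat.split intro: entails.refl entails_tsubst)
  then show ?case using eq.IH eq.prems by metis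
next
  case (C \<Gamma>)
  show ?case by (simp only: psubst.simps realizes_C)
qed

end


section \<open>The pole of runs\<close>

text \<open>Under the pairing bijection the constants of value \<open>k\<close> are the codes of the
  pairs \<open>(k, i)\<close>, one for every \<open>i\<close>.\<close>

definition val :: "nat \<Rightarrow> nat" where
  "val q = fst (prod_decode q)"

lemma fresh_val:
  assumes "finite F"
  obtains q where "val q = k" "q \<notin> F"
proof -
  have "inj (\<lambda>i. prod_encode (k, i))" by (simp add: inj_on_def)
  then have "infinite (range (\<lambda>i. prod_encode (k, i)))"
    using finite_imageD infinite_UNIV_nat by blast
  then have "\<not> range (\<lambda>i. prod_encode (k, i)) \<subseteq> F"
    using assms finite_subset by blast
  then obtain i where "prod_encode (k, i) \<notin> F" by blast
  then show thesis by (rule that [rotated]) (simp add: val_def)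
qed

text \<open>Quantifying over all \<open>q'\<close> of value \<open>k\<close> leaves room to pick a
  fresh one, and leastness makes every chain of such picks finite.\<close>

inductive runs :: "nat \<Rightarrow> nat \<Rightarrow> lam \<Rightarrow> bool" for x g where
  zero: "val q = 0 \<Longrightarrow> runs x g (Var x \<degree> Stk q)"
| succ: "\<lbrakk>val q = Suc k; \<And>q'. val q' = k \<Longrightarrow> runs x g (t \<degree> Stk q')\<rbrakk> \<Longrightarrow>
    runs x g (Var g \<degree> t \<degree> Stk q)"
| step: "\<lbrakk>step u v; runs x g v\<rbrakk> \<Longrightarrow> runs x g u"

text \<open>Here \<open>i\<close> is the number of constants introduced after \<open>Q 0\<close>; the sequence of the theorem is
  continued from its \<open>i\<close>-th term.\<close>

lemma runs_sequence:
  assumes "runs x g u" and "inj_on Q {..i}" and "stks u \<subseteq> Q ` {..i}"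
  shows "\<exists>m\<ge>i. \<exists>Q' r t. inj_on Q' {..m} \<and> (\<forall>j\<le>i. Q' j = Q j) \<and>
    (\<forall>j\<in>{i..m}. r j \<le> j) \<and>
    (\<forall>j\<in>{i..<m}. (if j = i then u else t j \<degree> Stk (Q' j)) \<succ>\<^sub>C
       Var g \<degree> t (Suc j) \<degree> Stk (Q' (r j)) \<and> val (Q' (r j)) = Suc (val (Q' (Suc j)))) \<and>
    (if m = i then u else t m \<degree> Stk (Q' m)) \<succ>\<^sub>C Var x \<degree> Stk (Q' (r m)) \<and>
    val (Q' (r m)) = 0"
  using assms
proof (induction arbitrary: Q i rule: runs.induct)
  case (zero q)
  \<comment> \<open>The constant met is one of those listed by \<open>Q\<close>; its position
    \<open>j\<close> becomes the index \<open>r i\<close>.\<close>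
  then obtain j where j: "j \<le> i" "q = Q j" by auto
  show ?case
  proof (intro exI conjI ballI)
    show "i \<le> i" "inj_on Q {..i}" "\<forall>j\<le>i. Q j = Q j" using zero.prems by simp_all
    show "(\<lambda>_. j) l \<le> l" if "l \<in> {i..i}" for l using that j by simp
    \<comment> \<open>Here \<open>m = i\<close>, so no \<open>t j\<close> is consulted and
      \<open>undefined\<close> serves.\<close>
    show "(if i = i then Var x \<degree> Stk q else undefined i \<degree> Stk (Q i)) \<succ>\<^sub>C Var x \<degree> Stk (Q j)"
      "val (Q j) = 0"
      using zero.hyps j by simp_all
  qed simp_all
next
  case (succ q k t)
  then obtain j where j: "j \<le> i" "q = Q j" by auto
  \<comment> \<open>Freshness keeps the list injective, and value \<open>k\<close> makes the
    induction hypothesis available for \<open>q'\<close>.\<close>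
  obtain q' where q': "val q' = k" "q' \<notin> Q ` {..i}"
    using fresh_val [of "Q ` {..i}"] by blast
  let ?Q = "Q(Suc i := q')"
  have "inj_on ?Q {..Suc i}"
    using succ.prems(1) q'(2) by (auto simp: inj_on_def le_Suc_eq)
  moreover have "?Q ` {..Suc i} = insert q' (Q ` {..i})"
    by (auto simp: le_Suc_eq image_iff)
  then have "stks (t \<degree> Stk q') \<subseteq> ?Q ` {..Suc i}"
    using succ.prems(2) by auto
  ultimately have "\<exists>m\<ge>Suc i. \<exists>Q' r t'. inj_on Q' {..m} \<and> (\<forall>j\<le>Suc i. Q' j = ?Q j) \<and>
    (\<forall>j\<in>{Suc i..m}. r j \<le> j) \<and>
    (\<forall>j\<in>{Suc i..<m}. (if j = Suc i then t \<degree> Stk q' else t' j \<degree> Stk (Q' j)) \<succ>\<^sub>C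
       Var g \<degree> t' (Suc j) \<degree> Stk (Q' (r j)) \<and> val (Q' (r j)) = Suc (val (Q' (Suc j)))) \<and>
    (if m = Suc i then t \<degree> Stk q' else t' m \<degree> Stk (Q' m)) \<succ>\<^sub>C Var x \<degree> Stk (Q' (r m)) \<and>
    val (Q' (r m)) = 0"
    by (rule succ.IH [OF q'(1)])
  then obtain m Q' r t' where m: "Suc i \<le> m" and inj: "inj_on Q' {..m}"
    and Q': "\<forall>j\<le>Suc i. Q' j = ?Q j"
    and r: "\<forall>j\<in>{Suc i..m}. r j \<le> j"
    and steps: "\<forall>j\<in>{Suc i..<m}.
      (if j = Suc i then t \<degree> Stk q' else t' j \<degree> Stk (Q' j)) \<succ>\<^sub>C
         Var g \<degree> t' (Suc j) \<degree> Stk (Q' (r j)) \<and> val (Q' (r j)) = Suc (val (Q' (Suc j)))"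
    and last: "(if m = Suc i then t \<degree> Stk q' else t' m \<degree> Stk (Q' m)) \<succ>\<^sub>C
      Var x \<degree> Stk (Q' (r m))" "val (Q' (r m)) = 0"
    by (elim exE conjE)
  \<comment> \<open>The move just made is recorded: its index \<open>j\<close> at \<open>i\<close>,
    its argument \<open>t\<close> at \<open>Suc i\<close>, because \<open>t\<close> is next applied
    to \<open>Q' (Suc i)\<close>.\<close>
  let ?r = "r(i := j)" and ?t = "t'(Suc i := t)"
  have "(if l = i then Var g \<degree> t \<degree> Stk q else ?t l \<degree> Stk (Q' l)) \<succ>\<^sub>C
      Var g \<degree> ?t (Suc l) \<degree> Stk (Q' (?r l)) \<and> val (Q' (?r l)) = Suc (val (Q' (Suc l)))"
    if l: "l \<in> {i..<m}" for l
  proof (cases "l = i")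
    case True
    then show ?thesis using j q' succ.hyps Q' by auto
  next
    case False
    with l Q' bspec [OF steps, of l] show ?thesis by (cases "l = Suc i") auto
  qed
  note steps' = this
  show ?case
  proof (intro exI conjI ballI)
    show "i \<le> m" using m by simp
    show "inj_on Q' {..m}" by (fact inj)
    show "\<forall>l\<le>i. Q' l = Q l" using Q' by auto
    show "?r l \<le> l" if "l \<in> {i..m}" for l using that r j by auto
    show "(if l = i then Var g \<degree> t \<degree> Stk q else ?t l \<degree> Stk (Q' l)) \<succ>\<^sub>C
        Var g \<degree> ?t (Suc l) \<degree> Stk (Q' (?r l))"
      "val (Q' (?r l)) = Suc (val (Q' (Suc l)))" if "l \<in> {i..<m}" for l
      using steps' [OF that] by blast+
    show "(if m = i then Var g \<degree> t \<degree> Stk q else ?t m \<degree> Stk (Q' m)) \<succ>\<^sub>C Var x \<degree> Stk (Q' (?r m))"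
      "val (Q' (?r m)) = 0"
      using last m Q' by (auto split: if_splits)
  qed
next
  case (step u v)
  \<comment> \<open>Reduction creates no constants, so the induction hypothesis applies with the
    same \<open>Q\<close> and \<open>i\<close>.\<close>
  then have "stks v \<subseteq> Q ` {..i}" using stks_step by blast
  from step.IH [OF step.prems(1) this] obtain m Q' r t where m: "i \<le> m"
    and *: "inj_on Q' {..m}" "\<forall>j\<le>i. Q' j = Q j" "\<forall>j\<in>{i..m}. r j \<le> j"
    and steps: "\<forall>j\<in>{i..<m}. (if j = i then v else t j \<degree> Stk (Q' j)) \<succ>\<^sub>C
       Var g \<degree> t (Suc j) \<degree> Stk (Q' (r j)) \<and> val (Q' (r j)) = Suc (val (Q' (Suc j)))"
    and last: "(if m = i then v else t m \<degree> Stk (Q' m)) \<succ>\<^sub>C Var x \<degree> Stk (Q' (r m))"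
      "val (Q' (r m)) = 0"
    by (elim exE conjE)
  have uv: "(if j = i then v else t j \<degree> Stk (Q' j)) \<succ>\<^sub>C w \<Longrightarrow>
      (if j = i then u else t j \<degree> Stk (Q' j)) \<succ>\<^sub>C w" for j w
    using step.hyps(1) by (auto intro: converse_rtranclp_into_rtranclp)
  show ?case
  proof (intro exI conjI ballI)
    show "i \<le> m" by (fact m)
    show "inj_on Q' {..m}" "\<forall>j\<le>i. Q' j = Q j" using * by blast+
    show "r j \<le> j" if "j \<in> {i..m}" for j using * that by blast
    show "(if j = i then u else t j \<degree> Stk (Q' j)) \<succ>\<^sub>C Var g \<degree> t (Suc j) \<degree> Stk (Q' (r j))"
      "val (Q' (r j)) = Suc (val (Q' (Suc j)))" if "j \<in> {i..<m}" for j
      using bspec [OF steps that] uv by blast+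
    show "(if m = i then u else t m \<degree> Stk (Q' m)) \<succ>\<^sub>C Var x \<degree> Stk (Q' (r m))"
      "val (Q' (r m)) = 0"
      using last uv by blast+
  qed
qed

section \<open>Numerals and the interpretation of \<open>N\<close>\<close>

lemma tsubst_numeral [simp]: "tsubst \<sigma> (numeral_trm zero succ n) = numeral_trm zero succ n"
  by (induction n) auto

lemma wf_numeral: "ar zero = 0 \<Longrightarrow> ar succ = 1 \<Longrightarrow> wf_trm ar (numeral_trm zero succ n)"
  by (induction n) auto

lemma C2_N_runs:
  fixes ar :: "'f \<Rightarrow> nat"
  assumes "ar zero = 0" "ar succ = 1" "wf_eqs ar E" "adequate ar zero succ E"
    and der: "C2 ar E [] \<theta> (N zero succ (numeral_trm zero succ n))" and q: "val q = n"
  shows "runs x g (\<theta> \<degree> Var x \<degree> Var g \<degree> Stk q)"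
proof -
  interpret pole_model ar E "runs x g"
    by unfold_locales (fact assms(3), rule runs.step)
  let ?num = "numeral_trm zero succ"
  define P where "P ts = {[Stk q] |q. entails ar E (?num (val q)) (hd ts)}" for ts
  have wf: "wf_trm ar (?num k)" for k
    using assms by (simp add: wf_numeral)
  have neq: "\<not> entails ar E (Fn succ [a]) (Fn zero [])" if "wf_trm ar a" for a
    using assms(4) that by (simp add: adequate_def)
  have inj: "entails ar E a b" if "entails ar E (Fn succ [a]) (Fn succ [b])" "wf_trm ar a" "wf_trm ar b"
    for a b
    using assms(4) that by (simp add: adequate_def)
  have P: "ext 1 P"
    unfolding ext_def P_def
  proof (intro allI impI)
    fix ts ts' :: "'f trm list"
    assume "length ts = 1" "list_all2 (entails ar E) ts ts'"
    then have "entails ar E (hd ts) (hd ts')"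
      by (auto simp: length_Suc_conv list_all2_Cons1)
    then have "entails ar E a (hd ts) \<longleftrightarrow> entails ar E a (hd ts')" for a
      by (meson entails.sym entails.trans)
    then show "{[Stk q] |q. entails ar E (?num (val q)) (hd ts)} =
        {[Stk q] |q. entails ar E (?num (val q)) (hd ts')}"
      by simp
  qed
  have x: "realizes (Var x) (P [Fn zero []])"
    unfolding realizes_def P_def
  proof clarsimp
    fix q assume q: "entails ar E (?num (val q)) (Fn zero [])"
    \<comment> \<open>A successor value would make some \<open>Fn succ [a]\<close> entailed equal to
      zero.\<close>
    have "val q = 0"
      using q neq [OF wf] by (cases "val q") simp_all
    then show "runs x g (Var x \<degree> Stk q)" by (rule runs.zero)
  qed
  have g: "runs x g (Var g \<degree> t \<degree> Stk q)"
    if a: "wf_trm ar a" and t: "realizes t (P [a])" and q: "entails ar E (?num (val q)) (Fn succ [a])"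
    for a t q
  proof (cases "val q")
    case 0
    then show ?thesis using neq [OF a] entails.sym [OF q] by simp
  next
    case (Suc k)
    \<comment> \<open>Cancelling the successor puts every \<open>[Stk q']\<close> with
      \<open>val q' = k\<close> into \<open>P [a]\<close>, which yields the premise of
      \<open>runs.succ\<close>.\<close>
    then have "entails ar E (?num k) a" using inj [OF _ wf a] q by simp
    then have "runs x g (t \<degree> Stk q')" if "val q' = k" for q'
      using t that by (auto simp: realizes_def P_def)
    with Suc show ?thesis by (rule runs.succ)
  qed
  \<comment> \<open>The formula has no free variables, so the valuations are arbitrary admissible
    ones.\<close>
  have "realizes (psubst Var \<theta>) (sem (N zero succ (?num n)) TVar (\<lambda>_ _ _. {}))"
    by (rule adequacy [OF der]) (auto simp: ext_def)
  moreover have "[Var x, Var g, Stk q] \<in> sem (N zero succ (?num n)) TVar (\<lambda>_ _ _. {})"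
  proof -
    have g': "realizes (Var g)
        (\<Union>a\<in>{a. wf_trm ar a}. {t # \<pi> |t \<pi>. realizes t (P [a]) \<and> \<pi> \<in> P [Fn succ [a]]})"
      unfolding realizes_def [of "Var g"]
    proof
      fix \<pi> assume "\<pi> \<in> (\<Union>a\<in>{a. wf_trm ar a}.
        {t # \<pi> |t \<pi>. realizes t (P [a]) \<and> \<pi> \<in> P [Fn succ [a]]})"
      then obtain a t q where "\<pi> = [t, Stk q]" "wf_trm ar a" "realizes t (P [a])"
        "entails ar E (?num (val q)) (Fn succ [a])"
        unfolding P_def [of "[Fn succ [a]]" for a] by auto
      then show "runs x g (Var g \<degree>\<degree> \<pi>)" using g by simp
    qed
    have "[Stk q] \<in> P [?num n]"
      using q entails.refl [OF wf] by (auto simp: P_def)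
    then have "[Var x, Var g, Stk q] \<in> sem (Imp (Atom 0 [Fn zero []])
       (Imp (All1 (Imp (Atom 0 [TVar 0]) (Atom 0 [Fn succ [TVar 0]])))
         (Atom 0 [?num n]))) TVar ((\<lambda>_ _ _. {})(1 := case_nat P (\<lambda>_ _. {})))"
      using x g' by simp
    then show ?thesis
      using P unfolding N_def sem.simps(5) by blast
  qed
  ultimately have "runs x g (psubst Var \<theta> \<degree>\<degree> [Var x, Var g, Stk q])"
    unfolding realizes_def [of "psubst Var \<theta>"] by (rule bspec)
  then show ?thesis by (simp add: psubst_Var)
qed

section \<open>From one run to arbitrary stack constants\<close>

theorem theorem5p4:
  fixes ar :: "'f \<Rightarrow> nat" and zero succ :: 'f
    and E :: "('f trm \<times> 'f trm) set"
    and n :: nat and \<theta> :: lam and x g :: nat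
  assumes "ar zero = 0" and "ar succ = 1"
    and "wf_eqs ar E" and "adequate ar zero succ E"
    and "closed \<theta>"
    and "C2 ar E [] \<theta> (N zero succ (numeral_trm zero succ n))"
    and "x \<noteq> g"
  shows "(n = 0 \<longrightarrow> (\<forall>p. \<theta> \<degree> Var x \<degree> Var g \<degree> Stk p \<succ>\<^sub>C Var x \<degree> Stk p)) \<and>
    (n \<noteq> 0 \<longrightarrow>
      (\<exists>(m::nat) (r :: nat \<Rightarrow> nat) (I :: nat \<Rightarrow> nat).
        m \<ge> 1 \<and> (\<forall>i\<in>{0..m}. r i \<in> {0..m}) \<and>
        I 0 = n \<and> I (r m) = 0 \<and>
        (\<forall>i\<in>{0..m-1}. int (I (i + 1)) = int (I (r i)) - 1) \<and>
        (\<forall>p :: nat \<Rightarrow> nat. inj_on p {0..m} \<longrightarrow>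
          (\<exists>t :: nat \<Rightarrow> lam.
            \<theta> \<degree> Var x \<degree> Var g \<degree> Stk (p 0) \<succ>\<^sub>C Var g \<degree> t 1 \<degree> Stk (p (r 0)) \<and>
            (\<forall>i\<in>{1..m-1}. t i \<degree> Stk (p i) \<succ>\<^sub>C Var g \<degree> t (i + 1) \<degree> Stk (p (r i))) \<and>
            t m \<degree> Stk (p m) \<succ>\<^sub>C Var x \<degree> Stk (p (r m))))))"
proof -
  obtain q where q: "val q = n" using fresh_val [of "{}"] by blast
  have stks: "stks \<theta> = {}" using assms(6) by (rule C2_stks)
  have "runs x g (\<theta> \<degree> Var x \<degree> Var g \<degree> Stk q)"
    by (rule C2_N_runs [OF assms(1-4,6) q])
  \<comment> \<open>The list starts with \<open>q\<close> alone, as \<open>\<theta>\<close> contains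
    no constants.\<close>
  from runs_sequence [OF this, of "\<lambda>_. q" 0] stks
  have "\<exists>m\<ge>0. \<exists>Q r t. inj_on Q {..m} \<and> (\<forall>j\<le>0. Q j = q) \<and> (\<forall>j\<in>{0..m}. r j \<le> j) \<and>
    (\<forall>j\<in>{0..<m}. (if j = 0 then \<theta> \<degree> Var x \<degree> Var g \<degree> Stk q else t j \<degree> Stk (Q j)) \<succ>\<^sub>C
       Var g \<degree> t (Suc j) \<degree> Stk (Q (r j)) \<and> val (Q (r j)) = Suc (val (Q (Suc j)))) \<and>
    (if m = 0 then \<theta> \<degree> Var x \<degree> Var g \<degree> Stk q else t m \<degree> Stk (Q m)) \<succ>\<^sub>C Var x \<degree> Stk (Q (r m)) \<and>
    val (Q (r m)) = 0"
    by simp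
  then obtain m Q r t where Q: "inj_on Q {..m}" "\<forall>j\<le>0. Q j = q"
    and r': "\<forall>j\<in>{0..m}. r j \<le> j"
    and steps': "\<forall>j\<in>{0..<m}.
        (if j = 0 then \<theta> \<degree> Var x \<degree> Var g \<degree> Stk q else t j \<degree> Stk (Q j)) \<succ>\<^sub>C
          Var g \<degree> t (Suc j) \<degree> Stk (Q (r j)) \<and> val (Q (r j)) = Suc (val (Q (Suc j)))"
    and last: "(if m = 0 then \<theta> \<degree> Var x \<degree> Var g \<degree> Stk q else t m \<degree> Stk (Q m)) \<succ>\<^sub>C
        Var x \<degree> Stk (Q (r m))" "val (Q (r m)) = 0"
    by (elim exE conjE)
  have Q0: "Q 0 = q" using Q(2) by simp
  have r: "r j \<le> j" if "j \<le> m" for j using r' that by simp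
  have steps: "(if j = 0 then \<theta> \<degree> Var x \<degree> Var g \<degree> Stk q else t j \<degree> Stk (Q j)) \<succ>\<^sub>C
      Var g \<degree> t (Suc j) \<degree> Stk (Q (r j))"
    and vals: "val (Q (r j)) = Suc (val (Q (Suc j)))" if "j < m" for j
    using bspec [OF steps', of j] that by auto
  have r0: "r 0 = 0" using r [of 0] by simp
  \<comment> \<open>If \<open>m = 0\<close>, the final value 0 is that of \<open>Q 0\<close>, namely
    \<open>n\<close>; otherwise the first move forces \<open>n\<close> to be a successor.\<close>
  have m0: "m = 0 \<longleftrightarrow> n = 0"
    using vals [of 0] last(2) r0 Q0 q by (cases "m = 0") auto
  \<comment> \<open>Since \<open>Q\<close> is injective on \<open>{..m}\<close>, inverting it there
    lets \<open>f p\<close> send each \<open>Q j\<close> to \<open>p j\<close>.\<close>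
  define f where "f p j = p (inv_into {..m} Q j)" for p :: "nat \<Rightarrow> nat" and j
  have f: "f p (Q j) = p j" if "j \<le> m" for p j
    using that Q(1) by (simp add: f_def)
  have start: "rename (f p) (\<theta> \<degree> Var x \<degree> Var g \<degree> Stk q) = \<theta> \<degree> Var x \<degree> Var g \<degree> Stk (p 0)" for p
    using f [of 0 p] Q0 by (simp add: rename_id stks)
  show ?thesis
  proof (intro conjI impI allI)
    fix p assume "n = 0"
    then show "\<theta> \<degree> Var x \<degree> Var g \<degree> Stk p \<succ>\<^sub>C Var x \<degree> Stk p"
      using rename_reduces [OF last(1), of "f (\<lambda>_. p)"] start [of "\<lambda>_. p"] m0 f [of 0 "\<lambda>_. p"] r0
      by simp
  next
    assume "n \<noteq> 0"
    with m0 have m: "m \<ge> 1" by simp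
    have play: "\<exists>t. \<theta> \<degree> Var x \<degree> Var g \<degree> Stk (p 0) \<succ>\<^sub>C Var g \<degree> t 1 \<degree> Stk (p (r 0)) \<and>
        (\<forall>i\<in>{1..m-1}. t i \<degree> Stk (p i) \<succ>\<^sub>C Var g \<degree> t (i + 1) \<degree> Stk (p (r i))) \<and>
        t m \<degree> Stk (p m) \<succ>\<^sub>C Var x \<degree> Stk (p (r m))" for p :: "nat \<Rightarrow> nat"
    proof (intro exI conjI ballI)
      \<comment> \<open>Only these terms depend on \<open>p\<close>; \<open>m\<close>,
        \<open>r\<close> and \<open>I\<close> come from the one run already fixed.\<close>
      let ?t = "\<lambda>i. rename (f p) (t i)"
      show "\<theta> \<degree> Var x \<degree> Var g \<degree> Stk (p 0) \<succ>\<^sub>C Var g \<degree> ?t 1 \<degree> Stk (p (r 0))"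
        using rename_reduces [OF steps [of 0], of "f p"] start [of p] m f [of 0 p] r0 by simp
      show "?t i \<degree> Stk (p i) \<succ>\<^sub>C Var g \<degree> ?t (i + 1) \<degree> Stk (p (r i))" if "i \<in> {1..m-1}" for i
      proof -
        have i: "i < m" "i \<noteq> 0" using that m by auto
        moreover have "r i \<le> m" using r [of i] i by simp
        ultimately show ?thesis
          using rename_reduces [OF steps [OF i(1)], of "f p"] f [of i p] f [of "r i" p] by simp
      qed
      show "?t m \<degree> Stk (p m) \<succ>\<^sub>C Var x \<degree> Stk (p (r m))"
        using rename_reduces [OF last(1), of "f p"] m f [of m p] f [of "r m" p] r [of m]
        by simp
    qed
    have "\<forall>i\<in>{0..m}. r i \<in> {0..m}"
    proof
      fix i assume "i \<in> {0..m}"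
      then show "r i \<in> {0..m}" using r [of i] by simp
    qed
    have "\<forall>i\<in>{0..m-1}. int (val (Q (i + 1))) = int (val (Q (r i))) - 1"
    proof
      fix i assume "i \<in> {0..m-1}"
      with m have "i < m" by auto
      then show "int (val (Q (i + 1))) = int (val (Q (r i))) - 1" using vals [of i] by simp
    qed
    have "val (Q 0) = n" using Q0 q by simp
    show "\<exists>(m::nat) (r :: nat \<Rightarrow> nat) (I :: nat \<Rightarrow> nat).
        m \<ge> 1 \<and> (\<forall>i\<in>{0..m}. r i \<in> {0..m}) \<and>
        I 0 = n \<and> I (r m) = 0 \<and>
        (\<forall>i\<in>{0..m-1}. int (I (i + 1)) = int (I (r i)) - 1) \<and>
        (\<forall>p :: nat \<Rightarrow> nat. inj_on p {0..m} \<longrightarrow>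
          (\<exists>t :: nat \<Rightarrow> lam.
            \<theta> \<degree> Var x \<degree> Var g \<degree> Stk (p 0) \<succ>\<^sub>C Var g \<degree> t 1 \<degree> Stk (p (r 0)) \<and>
            (\<forall>i\<in>{1..m-1}. t i \<degree> Stk (p i) \<succ>\<^sub>C Var g \<degree> t (i + 1) \<degree> Stk (p (r i))) \<and>
            t m \<degree> Stk (p m) \<succ>\<^sub>C Var x \<degree> Stk (p (r m))))"
      \<comment> \<open>\<open>I\<close> records the values of the constants \<open>Q i\<close> of
        the fixed run, not those of the given \<open>p i\<close>.\<close>
      by (rule exI [of _ m], rule exI [of _ r], rule exI [of _ "\<lambda>i. val (Q i)"],
          intro conjI allI impI) (fact | rule play)+
  qed
qed

end
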